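(* Let $b\ge 2$ be an integer, $\mathcal{D}=\{0,1,\dots,b-1\}$, and let $E\subseteq\mathcal{D}$ be a nonempty set of excluded digits, with $A=\mathcal{D}\setminus E$. Let $E_1=E$ if $0\notin E$ and $E_1=(E\cup\{b\})\setminus\{0\}$ if $0\in E$. Then \[ K(b,E)=\frac{b}{\#E}\log(b)+\frac1b\int_{[0,1)}\sum_{a\in E_1}\Bigl(\psi\bigl(\tfrac{a+x}{b}\bigr)-\psi(1)\Bigr)\,\mu_E(\mathrm{d}x), \] where $\psi=\Gamma'/\Gamma$ is the digamma function.
   Context: $K(b,E)$ denotes the sum of $1/m$ over all positive integers $m$ none of whose base-$b$ digits lies in $E$ (an empty sum, equal to $0$, if $E$ contains all positive digits). The measure $\mu_E$ on $[0,1)$ is defined as follows: for every finite string $X=(d_l,\dots,d_1)$ of length $l\ge0$ with all $d_i\in A$ (including the empty string, $l=0$), put $n(X)=d_lb^{l-1}+\dots+d_1$ (with $n(\text{empty})=0$); then $\mu_E=\sum_X b^{-l}\,\delta_{n(X)/b^{l}}$, the sum over all such strings, where $\delta_y$ is the Dirac mass at $y$. This measure has finite total mass $b/\#E$. *)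

theory Defs
  imports "HOL-Analysis.Analysis" "HOL-Probability.Giry_Monad"
begin

text \<open>The positions \<open>i\<close> with \<open>b ^ i \<le> m\<close> are exactly those up to the leading digit of \<open>m > 0\<close>, so
  leading zeros do not count as digits.\<close>

definition base_digits :: "nat \<Rightarrow> nat \<Rightarrow> nat set" where
  "base_digits b m = {(m div b ^ i) mod b | i. b ^ i \<le> m}"

definition kempner_set :: "nat \<Rightarrow> nat set \<Rightarrow> nat set" where
  "kempner_set b E = {m. m > 0 \<and> base_digits b m \<inter> E = {}}"

definition kempner_sum :: "nat \<Rightarrow> nat set \<Rightarrow> real" where
  "kempner_sum b E = (\<Sum>\<^sub>\<infinity>m\<in>kempner_set b E. 1 / real m)"

definition allowed_digits :: "nat \<Rightarrow> nat set \<Rightarrow> nat set" where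
  "allowed_digits b E = {0..<b} - E"

text \<open>Strings are lists with the least significant digit first: \<open>X ! i\<close> is $d_{i+1}$.\<close>

definition string_value :: "nat \<Rightarrow> nat list \<Rightarrow> nat" where
  "string_value b X = (\<Sum>i<length X. X ! i * b ^ i)"

definition unit_borel :: "real measure" where
  "unit_borel = restrict_space borel {0..<1}"

text \<open>\<open>return unit_borel y\<close> is the Dirac mass at \<open>y\<close>; integration against the counting measure is
  the (unordered, possibly infinite) sum over all strings in the allowed digits.\<close>

definition mu_E :: "nat \<Rightarrow> nat set \<Rightarrow> real measure" where
  "mu_E b E = measure_of (space unit_borel) (sets unit_borel)
     (\<lambda>S. \<integral>\<^sup>+X. ennreal (1 / real b ^ length X) *
            emeasure (return unit_borel (real (string_value b X) / real b ^ length X)) S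
          \<partial>count_space (lists (allowed_digits b E)))"

definition shifted_excluded :: "nat \<Rightarrow> nat set \<Rightarrow> nat set" where
  "shifted_excluded b E = (if 0 \<in> E then (E \<union> {b}) - {0} else E)"


text \<open>Well-definedness: \<open>mu_E\<close> is the intended sum of Dirac masses and has total mass \<open>b / card E\<close>,
  the Kempner series converges, and the integrand of the main formula is integrable, so that none of
  the totalised operations involved takes a default value.\<close>

lemma space_unit_borel: "space unit_borel = {0..<1}"
  and sets_unit_borel: "sets unit_borel = sets (restrict_space borel {0..<1})"
  by (simp_all add: unit_borel_def space_restrict_space)

lemma space_mu_E: "space (mu_E b E) = {0..<1}"
  and sets_mu_E: "sets (mu_E b E) = sets unit_borel"
  by (simp_all add: mu_E_def space_unit_borel [symmetric])

lemma string_value_less: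
  assumes "set X \<subseteq> {0..<b}" "b > 0"
  shows "string_value b X < b ^ length X"
  using assms(1)
proof (induction X rule: rev_induct)
  case Nil
  then show ?case by (simp add: string_value_def)
next
  case (snoc d X)
  have "string_value b (X @ [d]) = string_value b X + d * b ^ length X"
    by (simp add: string_value_def nth_append)
  also have "\<dots> < b ^ length X + d * b ^ length X"
    using snoc by simp
  also have "\<dots> = Suc d * b ^ length X" by simp
  also have "\<dots> \<le> b * b ^ length X"
    using snoc.prems by (intro mult_right_mono) auto
  finally show ?case by simp
qed

lemma emeasure_mu_E:
  assumes "S \<in> sets unit_borel"
  shows "emeasure (mu_E b E) S =
     (\<integral>\<^sup>+X. ennreal (1 / real b ^ length X) *
        indicator S (real (string_value b X) / real b ^ length X)
      \<partial>count_space (lists (allowed_digits b E)))"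
proof -
  define f where "f = (\<lambda>S. \<integral>\<^sup>+X. ennreal (1 / real b ^ length X) *
            emeasure (return unit_borel (real (string_value b X) / real b ^ length X)) S
          \<partial>count_space (lists (allowed_digits b E)))"
  have "countably_additive (sets unit_borel) f"
  proof (rule countably_additiveI)
    fix F :: "nat \<Rightarrow> real set"
    assume F: "range F \<subseteq> sets unit_borel" "disjoint_family F" "\<Union> (range F) \<in> sets unit_borel"
    have *: "(\<Sum>i. emeasure (return unit_borel y) (F i)) = emeasure (return unit_borel y) (\<Union> (range F))"
      for y using F by (intro suminf_emeasure) auto
    show "(\<Sum>i. f (F i)) = f (\<Union> (range F))"
      unfolding f_def by (subst nn_integral_suminf [symmetric]) (simp_all flip: *)
  qed
  moreover have "positive (sets unit_borel) f"
    by (simp add: positive_def f_def)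
  ultimately have "measure_space (space unit_borel) (sets unit_borel) f"
    by (simp add: measure_space_def sets.sigma_algebra_axioms)
  hence "emeasure (mu_E b E) S = f S"
    unfolding mu_E_def f_def [symmetric]
    using assms by (intro emeasure_measure_of_sigma)
      (auto simp: measure_space_def sets.sigma_algebra_axioms)
  thus ?thesis using assms by (simp add: f_def)
qed

lemma nn_integral_lists_weight:
  assumes "b \<ge> 2" "E \<subseteq> {0..<b}" "E \<noteq> {}"
  shows "(\<integral>\<^sup>+X. ennreal (1 / real b ^ length X) \<partial>count_space (lists (allowed_digits b E)))
           = ennreal (real b / real (card E))"
proof -
  define A where "A = allowed_digits b E"
  have fin: "finite A" and finE: "finite E"
    using assms finite_subset by (auto simp: A_def allowed_digits_def)
  have cardE: "card E > 0" "card E \<le> b"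
    using assms finE card_mono [of "{0..<b}" E] by (auto simp: card_gt_0_iff)
  have cardA: "card A = b - card E"
    using assms finE by (simp add: A_def allowed_digits_def card_Diff_subset)
  define q where "q = real (card A) / real b"
  have q: "0 \<le> q" "q < 1" and q1: "1 - q = real (card E) / real b"
    using cardE cardA assms(1) by (auto simp: q_def field_simps of_nat_diff)
  have "(\<integral>\<^sup>+X. ennreal (1 / real b ^ length X) \<partial>count_space (lists A))
      = (\<integral>\<^sup>+X. (\<Sum>l. if l = length X then ennreal (1 / real b ^ l) else 0) \<partial>count_space (lists A))"
  proof (rule nn_integral_cong)
    fix X :: "nat list"
    have "(\<lambda>l. if l = length X then ennreal (1 / real b ^ l) else 0) sums
            ennreal (1 / real b ^ length X)"
      by (rule sums_single)
    thus "ennreal (1 / real b ^ length X) =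
        (\<Sum>l. if l = length X then ennreal (1 / real b ^ l) else 0)"
      by (simp add: sums_iff)
  qed
  also have "\<dots> = (\<Sum>l. \<integral>\<^sup>+X. (if l = length X then ennreal (1 / real b ^ l) else 0) \<partial>count_space (lists A))"
    by (rule nn_integral_suminf) simp
  also have "\<dots> = (\<Sum>l. ennreal (q ^ l))"
  proof (rule arg_cong[where f = suminf], rule ext)
    fix l
    let ?B = "{X. set X \<subseteq> A \<and> length X = l}"
    have "(\<integral>\<^sup>+X. (if l = length X then ennreal (1 / real b ^ l) else 0) \<partial>count_space (lists A))
        = (\<Sum>X\<in>?B. if l = length X then ennreal (1 / real b ^ l) else 0)"
      using fin by (intro nn_integral_count_space') (auto simp: finite_lists_length_eq)
    also have "\<dots> = (\<Sum>X\<in>?B. ennreal (1 / real b ^ l))"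
      by (intro sum.cong) auto
    also have "\<dots> = ennreal (\<Sum>X\<in>?B. 1 / real b ^ l)"
      by (rule sum_ennreal) simp
    also have "(\<Sum>X\<in>?B. 1 / real b ^ l) = q ^ l"
      using fin by (simp add: card_lists_length_eq q_def power_divide)
    finally show "(\<integral>\<^sup>+X. (if l = length X then ennreal (1 / real b ^ l) else 0)
        \<partial>count_space (lists A)) = ennreal (q ^ l)" .
  qed
  also have "\<dots> = ennreal (\<Sum>l. q ^ l)"
    using q by (intro suminf_ennreal2) (auto intro: summable_geometric)
  also have "(\<Sum>l. q ^ l) = real b / real (card E)"
    using q q1 by (subst suminf_geometric) auto
  finally show ?thesis by (simp add: A_def)
qed

lemma emeasure_mu_E_total:
  assumes "b \<ge> 2" "E \<subseteq> {0..<b}" "E \<noteq> {}"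
  shows "emeasure (mu_E b E) {0..<1} = ennreal (real b / real (card E))"
proof -
  have S: "{0..<1} \<in> sets unit_borel"
    using sets.top[of unit_borel] by (simp add: space_unit_borel)
  have "emeasure (mu_E b E) {0..<1} =
     (\<integral>\<^sup>+X. ennreal (1 / real b ^ length X) \<partial>count_space (lists (allowed_digits b E)))"
    unfolding emeasure_mu_E[OF S]
  proof (rule nn_integral_cong)
    fix X assume "X \<in> space (count_space (lists (allowed_digits b E)))"
    hence "string_value b X < b ^ length X"
      using assms by (intro string_value_less) (auto simp: allowed_digits_def)
    hence "real (string_value b X) < real b ^ length X"
      by (metis of_nat_less_iff of_nat_power)
    hence "real (string_value b X) / real b ^ length X \<in> {0..<1}"
      using assms(1) by (simp add: divide_less_eq)
    thus "ennreal (1 / real b ^ length X) *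
        indicator {0..<1} (real (string_value b X) / real b ^ length X) =
        ennreal (1 / real b ^ length X)" by simp
  qed
  thus ?thesis using nn_integral_lists_weight[OF assms] by simp
qed

lemma finite_measure_mu_E:
  assumes "b \<ge> 2" "E \<subseteq> {0..<b}" "E \<noteq> {}"
  shows "finite_measure (mu_E b E)"
  by (rule finite_measureI) (simp add: space_mu_E emeasure_mu_E_total[OF assms])

lemma digit_expansion_mod:
  fixes b m n :: nat
  assumes "b > 0"
  shows "(\<Sum>i<n. (m div b ^ i mod b) * b ^ i) = m mod b ^ n"
proof (induction n)
  case (Suc n)
  have "m mod b ^ Suc n = b ^ n * (m div b ^ n mod b) + m mod b ^ n"
    by (metis mod_mult2_eq power_Suc2)
  thus ?case using Suc by simp
qed simp

lemma kempner_summable: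
  assumes "b \<ge> 2" "E \<subseteq> {0..<b}" "E \<noteq> {}"
  shows "(\<lambda>m. 1 / real m) summable_on kempner_set b E"
proof -
  define A where "A = allowed_digits b E"
  define w where "w = (\<lambda>X :: nat list. 1 / real b ^ length X)"
  have "Infinite_Set_Sum.abs_summable_on w (lists A)"
    unfolding w_def A_def
    using nn_integral_lists_weight[OF assms]
    by (auto simp: Infinite_Set_Sum.abs_summable_on_def integrable_iff_bounded norm_divide norm_power)
  hence w: "w summable_on lists A"
    by (metis abs_summable_equivalent abs_summable_summable)
  define len where "len = (\<lambda>m. LEAST n. m < b ^ n)"
  define dg where "dg = (\<lambda>m. map (\<lambda>i. m div b ^ i mod b) [0..<len m])"
  have len: "m < b ^ len m" for m
    unfolding len_def
  proof (rule LeastI)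
    have "m < 2 ^ m" by (rule less_exp)
    also have "\<dots> \<le> b ^ m" using assms(1) by (intro power_mono) auto
    finally show "m < b ^ m" .
  qed
  have len': "b ^ i \<le> m" if "i < len m" for i m
    using not_less_Least[of i "\<lambda>n. m < b ^ n"] that by (simp add: len_def)
  have val: "string_value b (dg m) = m" for m
    using digit_expansion_mod[of b m "len m"] len[of m] assms(1)
    by (simp add: string_value_def dg_def)
  have inj: "inj_on dg (kempner_set b E)"
    by (metis inj_onI val)
  have sub: "dg ` kempner_set b E \<subseteq> lists A"
  proof safe
    fix m x assume "m \<in> kempner_set b E" "x \<in> set (dg m)"
    thus "x \<in> A"
      using len' assms(1)
      by (fastforce simp: dg_def kempner_set_def base_digits_def A_def allowed_digits_def)
  qed
  have "(w \<circ> dg) summable_on kempner_set b E"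
    using summable_on_subset_banach[OF w sub] summable_on_reindex[OF inj] by blast
  hence "(\<lambda>m. real b * (w \<circ> dg) m) summable_on kempner_set b E"
    by (rule summable_on_cmult_right)
  thus ?thesis
  proof (rule summable_on_comparison_test)
    fix m assume "m \<in> kempner_set b E"
    hence m: "m > 0" by (simp add: kempner_set_def)
    hence "len m > 0" using len[of m] by (cases "len m") auto
    then obtain n where n: "len m = Suc n" by (cases "len m") auto
    hence "b ^ n \<le> m" using len'[of n m] by simp
    hence "real b ^ n \<le> real m" by (metis of_nat_le_iff of_nat_power)
    moreover have "real b * (w \<circ> dg) m = 1 / real b ^ n"
      using assms(1) by (simp add: w_def dg_def n)
    ultimately show "1 / real m \<le> real b * (w \<circ> dg) m"
      using assms(1) m by (simp add: frac_le)
  qed simp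
qed

lemma integrable_main_integrand:
  assumes "b \<ge> 2" "E \<subseteq> {0..<b}" "E \<noteq> {}"
  shows "integrable (mu_E b E)
           (\<lambda>x. \<Sum>a\<in>shifted_excluded b E. Digamma ((real a + x) / real b) - Digamma 1)"
proof (rule Bochner_Integration.integrable_sum)
  fix a assume "a \<in> shifted_excluded b E"
  hence a: "a > 0" using assms by (auto simp: shifted_excluded_def split: if_splits intro: gr0I)
  interpret finite_measure "mu_E b E" by (rule finite_measure_mu_E[OF assms])
  let ?g = "\<lambda>x. Digamma ((real a + x) / real b) - Digamma 1"
  have cont: "continuous_on {0..1} ?g"
  proof (intro continuous_at_imp_continuous_on ballI continuous_intros)
    fix x :: real assume "x \<in> {0..1}"
    hence "(real a + x) / real b > 0" using a assms(1) by auto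
    thus "(real a + x) / real b \<notin> \<int>\<^sub>\<le>\<^sub>0" by (auto elim!: nonpos_Ints_cases)
  qed (use assms in auto)
  have "bounded (?g ` {0..1})"
    by (intro compact_imp_bounded compact_continuous_image cont) auto
  then obtain B where "\<forall>y\<in>?g ` {0..1}. norm y \<le> B"
    unfolding bounded_iff by (elim exE)
  hence B: "norm (?g x) \<le> B" if "x \<in> {0..1}" for x
    using that by (rule bspec[OF _ imageI])
  have "?g \<in> borel_measurable (restrict_space borel {0..<1})"
    by (rule borel_measurable_continuous_on_restrict, rule continuous_on_subset[OF cont]) auto
  hence "?g \<in> borel_measurable (mu_E b E)"
    by (simp add: sets_mu_E sets_unit_borel cong: measurable_cong_sets)
  thus "integrable (mu_E b E) ?g"
    by (intro integrable_const_bound[of _ B]) (rule AE_I2, rule B, simp add: space_mu_E)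
qed

end

theory Submission
  imports Defs
begin

text \<open>Stripping the leading digit \<open>a\<close> of the integers \<open>m = b\<^sup>l (a + x)\<close> counted by $K(b,E)$ gives
  $K(b,E) = \int \sum_{a \in A, a \neq 0} 1/(a+x)\,\mu_E(dx)$. Stripping the leading digit of a string gives
  the self-similarity $\int f\,d\mu_E = f(0) + \frac1b \sum_{a\in A} \int f((a+x)/b)\,\mu_E(dx)$. Apply the
  latter to $f(x) = \psi(1+x) - \psi(1)$, which vanishes at $0$: by $\psi(1+y) = \psi(y) + 1/y$ the right-hand
  side contains $K(b,E)$, and Gauss' multiplication formula, which evaluates the sum of
  $\psi((a+x)/b)$ over all $1 \le a \le b$ as $b\,\psi(1+x) - b \log b$, turns the sum over the allowed
  digits into one over the excluded ones, while the integrals of \<open>f\<close> cancel.\<close>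

section \<open>Gauss' multiplication formula for the digamma function\<close>

text \<open>Grouping indices by residue modulo \<open>b\<close> matches one partial sum of the
  digamma series at \<open>z\<close> with \<open>b\<close> partial sums at the points
  \<open>(a + z) / b\<close>.\<close>

lemma sum_lessThan_mult_nat:
  fixes f :: "nat \<Rightarrow> 'a::comm_monoid_add"
  shows "(\<Sum>j<b * m. f j) = (\<Sum>a<b. \<Sum>k<m. f (a + b * k))"
proof -
  have "(\<Sum>j<b * m. f j) = (\<Sum>k<m. \<Sum>j=k * b..<k * b + b. f j)"
    by (simp add: sum.nat_group mult.commute)
  also have "\<dots> = (\<Sum>k<m. \<Sum>a<b. f (a + b * k))"
  proof (rule sum.cong[OF refl])
    fix k
    show "(\<Sum>j=k * b..<k * b + b. f j) = (\<Sum>a<b. f (a + b * k))"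
      using sum.shift_bounds_nat_ivl[of f 0 "k * b" b]
      by (simp add: atLeast0LessThan add.commute mult.commute)
  qed
  also have "\<dots> = (\<Sum>a<b. \<Sum>k<m. f (a + b * k))"
    by (rule sum.swap)
  finally show ?thesis .
qed

text \<open>Both sides are limits of \<open>ln m\<close> minus partial sums of reciprocals. Scaling
  by \<open>b\<close> turns the terms at \<open>(a + z) / b\<close> into those of residue
  \<open>a\<close> in the series at \<open>z\<close>; the \<open>b\<close> discrepancies between
  \<open>ln (b * m)\<close> and \<open>ln m\<close> produce \<open>b * ln b\<close>.\<close>

theorem Digamma_multiplication:
  fixes z :: real
  assumes "z > 0" "b > 0"
  shows "(\<Sum>a<b. Digamma ((real a + z) / real b)) = real b * Digamma z - real b * ln (real b)"
proof -
  define S where "S = (\<lambda>m. ln (real m) - (\<Sum>n<m. inverse (z + real n)))"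
  have "S \<longlonglongrightarrow> Digamma z"
    using Digamma_LIMSEQ[of z] assms by (simp add: S_def)
  \<comment> \<open>Along multiples of \<open>b\<close> every residue class contributes exactly
    \<open>m\<close> terms.\<close>
  hence "(\<lambda>m. S (b * m)) \<longlonglongrightarrow> Digamma z"
    by (rule filterlim_compose) (use assms in \<open>auto intro!: mult_nat_left_at_top\<close>)
  hence R: "(\<lambda>m. real b * S (b * m) - real b * ln (real b)) \<longlonglongrightarrow>
      real b * Digamma z - real b * ln (real b)"
    by (intro tendsto_intros)
  have "(\<lambda>m. \<Sum>a<b. ln (real m) - (\<Sum>n<m. inverse ((real a + z) / real b + real n))) \<longlonglongrightarrow>
      (\<Sum>a<b. Digamma ((real a + z) / real b))"
  proof (rule tendsto_sum)
    fix a
    have "(real a + z) / real b \<noteq> 0" using assms by (simp add: add_nonneg_eq_0_iff)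
    from Digamma_LIMSEQ[OF this]
    show "(\<lambda>m. ln (real m) - (\<Sum>n<m. inverse ((real a + z) / real b + real n))) \<longlonglongrightarrow>
        Digamma ((real a + z) / real b)" by simp
  qed
  moreover have "\<forall>\<^sub>F m in sequentially.
      (\<Sum>a<b. ln (real m) - (\<Sum>n<m. inverse ((real a + z) / real b + real n))) =
      real b * S (b * m) - real b * ln (real b)"
    using eventually_gt_at_top[of 0]
  proof eventually_elim
    case (elim m)
    have inv: "inverse ((real a + z) / real b + real n) = real b * inverse (z + real (a + b * n))"
      for a n using assms by (simp add: field_simps)
    have "ln (real (b * m)) = ln (real b) + ln (real m)"
      using elim assms by (simp add: ln_mult)
    hence "real b * S (b * m) - real b * ln (real b) = real b * ln (real m) -
        (\<Sum>a<b. \<Sum>n<m. real b * inverse (z + real (a + b * n)))"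
      by (simp add: S_def sum_lessThan_mult_nat sum_distrib_left right_diff_distrib distrib_left)
    thus ?case by (simp only: inv sum_subtractf sum_constant card_lessThan)
  qed
  ultimately have "(\<lambda>m. real b * S (b * m) - real b * ln (real b)) \<longlonglongrightarrow>
      (\<Sum>a<b. Digamma ((real a + z) / real b))"
    by (rule Lim_transform_eventually)
  thus ?thesis using R LIMSEQ_unique by blast
qed

section \<open>Digit strings\<close>

lemma string_value_Cons: "string_value b (d # X) = d + b * string_value b X"
  unfolding string_value_def
  by (simp add: sum.lessThan_Suc_shift sum_distrib_left algebra_simps del: sum.lessThan_Suc)

lemma string_value_snoc: "string_value b (X @ [d]) = string_value b X + d * b ^ length X"
  by (simp add: string_value_def nth_append)

text \<open>The head is the least significant digit and is below \<open>b\<close>, so dividing the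
  value by \<open>b\<close> removes just the head.\<close>

lemma string_value_digit:
  assumes "set X \<subseteq> {0..<b}" "i < length X"
  shows "string_value b X div b ^ i mod b = X ! i"
  using assms
proof (induction X arbitrary: i)
  case (Cons d X)
  thus ?case
    by (cases i) (auto simp: string_value_Cons div_mult2_eq)
qed simp

text \<open>The last list entry is the leading digit; being nonzero, it forces the value up to at
  least \<open>b ^ (length X - 1)\<close>. This identifies the positions inspected by
  \<open>base_digits\<close> with the list positions.\<close>

lemma power_le_string_value_iff:
  assumes "set X \<subseteq> {0..<b}" "X \<noteq> []" "last X \<noteq> 0"
  shows "b ^ i \<le> string_value b X \<longleftrightarrow> i < length X"
proof -
  obtain Y d where X: "X = Y @ [d]" using assms(2) by (cases X rule: rev_cases) auto
  have b: "b > 0" using assms by (cases X) auto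
  have "1 * b ^ length Y \<le> d * b ^ length Y"
    using assms(3) X by (intro mult_right_mono) auto
  hence lower: "b ^ length Y \<le> string_value b X"
    unfolding X string_value_snoc by linarith
  have upper: "string_value b X < b ^ length X" using assms b by (intro string_value_less)
  show ?thesis
  proof
    assume "b ^ i \<le> string_value b X"
    with upper have "b ^ i < b ^ length X" by simp
    thus "i < length X" using b by (metis power_increasing leD leI One_nat_def Suc_leI)
  next
    assume "i < length X"
    hence "b ^ i \<le> b ^ length Y" using b by (intro power_increasing) (auto simp: X)
    thus "b ^ i \<le> string_value b X" using lower by simp
  qed
qed

lemma base_digits_string_value:
  assumes "set X \<subseteq> {0..<b}" "X \<noteq> []" "last X \<noteq> 0"
  shows "base_digits b (string_value b X) = set X"
  using string_value_digit[OF assms(1)]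
  by (force simp: base_digits_def power_le_string_value_iff[OF assms] set_conv_nth)

lemma string_value_surj:
  assumes "b \<ge> 2" "m > 0"
  obtains X where "set X \<subseteq> {0..<b}" "X \<noteq> []" "last X \<noteq> 0" "string_value b X = m"
  using assms(2)
proof (induction m arbitrary: thesis rule: less_induct)
  case (less m)
  show ?case
  proof (cases "m < b")
    case True
    thus ?thesis using less.prems
      by (intro less.prems(1)[of "[m]"]) (auto simp: string_value_def)
  next
    case False
    hence "m div b < m" "m div b > 0" using assms less.prems by (auto simp: div_greater_zero_iff)
    then obtain Y where Y: "set Y \<subseteq> {0..<b}" "Y \<noteq> []" "last Y \<noteq> 0" "string_value b Y = m div b"
      using less.IH by blast
    show ?thesis
      using Y assms by (intro less.prems(1)[of "m mod b # Y"]) (auto simp: string_value_Cons)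
  qed
qed

text \<open>Only the leading digit \<open>a\<close> has to be nonzero. The remaining string
  \<open>X\<close> is arbitrary and may itself have leading zeros, so it ranges over the same
  strings that index the atoms of \<open>mu_E\<close>.\<close>

lemma bij_betw_kempner_set:
  assumes "b \<ge> 2"
  shows "bij_betw (\<lambda>(a, X). string_value b (X @ [a]))
           ((allowed_digits b E - {0}) \<times> lists (allowed_digits b E)) (kempner_set b E)"
proof -
  \<comment> \<open>The canonical expansions: nonempty, with nonzero leading digit.\<close>
  define T where "T = {X \<in> lists (allowed_digits b E). X \<noteq> [] \<and> last X \<noteq> 0}"
  have T: "set X \<subseteq> {0..<b}" "X \<noteq> []" "last X \<noteq> 0" if "X \<in> T" for X
    using that by (auto simp: T_def allowed_digits_def)
  have "bij_betw (\<lambda>(a, X). X @ [a]) ((allowed_digits b E - {0}) \<times> lists (allowed_digits b E)) T"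
    by (rule bij_betwI[where g = "\<lambda>X. (last X, butlast X)"])
       (auto simp: T_def in_lists_conv_set dest: in_set_butlastD)
  moreover have "bij_betw (string_value b) T (kempner_set b E)"
  proof (rule bij_betwI')
    fix X Y assume XY: "X \<in> T" "Y \<in> T"
    show "string_value b X = string_value b Y \<longleftrightarrow> X = Y"
    proof
      assume eq: "string_value b X = string_value b Y"
      \<comment> \<open>The value determines which powers of \<open>b\<close> it dominates, hence
        the length.\<close>
      have "i < length X \<longleftrightarrow> i < length Y" for i
        using power_le_string_value_iff[OF T[OF XY(1)], of i]
          power_le_string_value_iff[OF T[OF XY(2)], of i] eq by simp
      hence len: "length X = length Y" by (metis linorder_neqE_nat less_irrefl)
      show "X = Y"
      proof (rule nth_equalityI[OF len])
        fix i assume "i < length X"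
        thus "X ! i = Y ! i"
          using string_value_digit[OF T(1)[OF XY(1)], of i]
            string_value_digit[OF T(1)[OF XY(2)], of i] eq len by simp
      qed
    qed simp
  next
    fix X assume X: "X \<in> T"
    have "b ^ 0 \<le> string_value b X"
      using power_le_string_value_iff[OF T[OF X], of 0] T[OF X] by simp
    moreover have "set X \<inter> E = {}"
      using X by (auto simp: T_def allowed_digits_def)
    ultimately show "string_value b X \<in> kempner_set b E"
      using base_digits_string_value[OF T[OF X]] by (simp add: kempner_set_def)
  next
    fix m assume m: "m \<in> kempner_set b E"
    then obtain X where X: "set X \<subseteq> {0..<b}" "X \<noteq> []" "last X \<noteq> 0" "string_value b X = m"
      using string_value_surj[OF assms] by (auto simp: kempner_set_def)
    moreover have "set X \<inter> E = {}"
      using m base_digits_string_value[OF X(1-3)] X(4) by (simp add: kempner_set_def)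
    ultimately have "X \<in> T" by (auto simp: T_def allowed_digits_def)
    thus "\<exists>X\<in>T. m = string_value b X" using X by blast
  qed
  ultimately have "bij_betw (string_value b \<circ> (\<lambda>(a, X). X @ [a]))
      ((allowed_digits b E - {0}) \<times> lists (allowed_digits b E)) (kempner_set b E)"
    by (rule bij_betw_trans)
  thus ?thesis by (simp add: o_def case_prod_unfold)
qed

section \<open>Integration against the measure\<close>

definition string_point :: "nat \<Rightarrow> nat list \<Rightarrow> real" where
  "string_point b X = real (string_value b X) / real b ^ length X"

lemma string_point_Nil [simp]: "string_point b [] = 0"
  by (simp add: string_point_def string_value_def)

text \<open>Appending to the list adds a new leading digit, which acts on points as a contraction of
  ratio \<open>1 / b\<close>. This is the source of the self-similarity.\<close>

lemma string_point_snoc: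
  assumes "b > 0"
  shows "string_point b (X @ [a]) = (real a + string_point b X) / real b"
  using assms by (simp add: string_point_def string_value_snoc field_simps)

lemma string_point_in_unit:
  assumes "b > 0" "X \<in> lists (allowed_digits b E)"
  shows "string_point b X \<in> {0..<1}"
proof -
  have "string_value b X < b ^ length X"
    using assms by (intro string_value_less) (auto simp: allowed_digits_def)
  hence "real (string_value b X) < real b ^ length X"
    by (metis of_nat_less_iff of_nat_power)
  thus ?thesis using assms(1) by (simp add: string_point_def divide_less_eq)
qed

text \<open>As a push-forward of a weighted counting measure, \<open>mu_E\<close> has integrals that
  can be computed on strings by change of variables.\<close>

lemma mu_E_eq_distr:
  assumes "b > 0"
  shows "mu_E b E = distr (density (count_space (lists (allowed_digits b E)))
            (\<lambda>X. ennreal (1 / real b ^ length X))) unit_borel (string_point b)"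
    (is "_ = distr (density ?C ?w) _ _")
proof (rule measure_eqI)
  have meas: "string_point b \<in> measurable (density ?C ?w) unit_borel"
    using string_point_in_unit[OF assms] by (simp add: space_unit_borel)
  fix S assume "S \<in> sets (mu_E b E)"
  hence S: "S \<in> sets unit_borel" by (simp add: sets_mu_E)
  have "emeasure (distr (density ?C ?w) unit_borel (string_point b)) S =
      (\<integral>\<^sup>+X. ?w X * indicator (string_point b -` S \<inter> lists (allowed_digits b E)) X \<partial>?C)"
    using S meas by (subst emeasure_distr) (auto simp: emeasure_density)
  also have "\<dots> = (\<integral>\<^sup>+X. ?w X * indicator S (string_point b X) \<partial>?C)"
    by (intro nn_integral_cong) (auto simp: indicator_def)
  finally show "emeasure (mu_E b E) S =
      emeasure (distr (density ?C ?w) unit_borel (string_point b)) S"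
    by (simp add: emeasure_mu_E[OF S] string_point_def)
qed (simp add: sets_mu_E)

text \<open>Integrability over a counting measure is absolute summability, so integrals become
  unordered sums, which may be regrouped by leading digit.\<close>

lemma has_sum_integral_mu_E:
  fixes f :: "real \<Rightarrow> real"
  assumes "b > 0" "integrable (mu_E b E) f"
  shows "((\<lambda>X. f (string_point b X) / real b ^ length X) has_sum (LINT x | mu_E b E. f x))
           (lists (allowed_digits b E))"
proof -
  let ?C = "count_space (lists (allowed_digits b E))"
  let ?w = "\<lambda>X. 1 / real b ^ length X"
  let ?g = "\<lambda>X. f (string_point b X) / real b ^ length X"
  have meas: "string_point b \<in> measurable (density ?C ?w) unit_borel"
    using string_point_in_unit[OF assms(1)] by (simp add: space_unit_borel)
  have f: "f \<in> borel_measurable unit_borel"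
    using borel_measurable_integrable[OF assms(2)] by (simp add: sets_mu_E cong: measurable_cong_sets)
  have "integrable ?C ?g"
    using assms(2) unfolding mu_E_eq_distr[OF assms(1)] integrable_distr_eq[OF meas f]
    by (subst (asm) integrable_density) auto
  hence s: "Infinite_Set_Sum.abs_summable_on ?g (lists (allowed_digits b E))"
    by (simp add: Infinite_Set_Sum.abs_summable_on_def)
  have "(LINT x | mu_E b E. f x) = (LINT X | ?C. ?g X)"
    unfolding mu_E_eq_distr[OF assms(1)] integral_distr[OF meas f]
    by (subst integral_density) auto
  also have "\<dots> = infsum ?g (lists (allowed_digits b E))"
    using infsetsum_infsum[OF s] by (simp add: infsetsum_def)
  finally show ?thesis
    using s by (metis abs_summable_equivalent abs_summable_summable has_sum_infsum)
qed

text \<open>Continuity is asked on the closed interval, although the measure lives on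
  \<open>{0..<1}\<close>, so that compactness bounds \<open>f\<close>; the total mass is
  finite.\<close>

lemma integrable_mu_E_continuous:
  fixes f :: "real \<Rightarrow> real"
  assumes "b \<ge> 2" "E \<subseteq> {0..<b}" "E \<noteq> {}" "continuous_on {0..1} f"
  shows "integrable (mu_E b E) f"
proof -
  interpret finite_measure "mu_E b E" by (rule finite_measure_mu_E[OF assms(1-3)])
  have "bounded (f ` {0..1})"
    by (intro compact_imp_bounded compact_continuous_image assms) auto
  then obtain B where "\<forall>y\<in>f ` {0..1}. norm y \<le> B"
    unfolding bounded_iff by (elim exE)
  hence B: "norm (f x) \<le> B" if "x \<in> {0..1}" for x
    using that by (rule bspec[OF _ imageI])
  have "f \<in> borel_measurable (restrict_space borel {0..<1})"
    by (rule borel_measurable_continuous_on_restrict, rule continuous_on_subset[OF assms(4)]) auto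
  hence "f \<in> borel_measurable (mu_E b E)"
    by (simp add: sets_mu_E sets_unit_borel cong: measurable_cong_sets)
  thus ?thesis
    by (intro integrable_const_bound[of _ B]) (rule AE_I2, rule B, simp add: space_mu_E)
qed

lemma finite_allowed_digits: "finite (allowed_digits b E)"
  by (simp add: allowed_digits_def)

text \<open>The empty string is an atom of weight 1 at 0 and gives \<open>f 0\<close>. Every other
  string has a leading digit \<open>a\<close>, whose extra position costs a factor
  \<open>1 / b\<close>.\<close>

lemma integral_mu_E_self_similar:
  fixes f :: "real \<Rightarrow> real"
  assumes "b \<ge> 2" "E \<subseteq> {0..<b}" "E \<noteq> {}" "continuous_on {0..1} f"
  shows "(LINT x | mu_E b E. f x) =
           f 0 + (\<Sum>a\<in>allowed_digits b E. LINT x | mu_E b E. f ((real a + x) / real b)) / real b"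
proof -
  define A where "A = allowed_digits b E"
  have b: "b > 0" using assms by simp
  let ?F = "\<lambda>X. f (string_point b X) / real b ^ length X"
  let ?h = "\<lambda>(a, X). X @ [a]"
  have lists_eq: "lists A = insert [] (?h ` (A \<times> lists A))"
  proof (intro equalityI subsetI)
    fix X assume "X \<in> lists A"
    thus "X \<in> insert [] (?h ` (A \<times> lists A))"
      by (cases X rule: rev_cases) (auto simp: image_iff)
  qed auto
  have inj: "inj_on ?h (A \<times> lists A)" by (auto simp: inj_on_def)
  have sum: "(?F has_sum (LINT x | mu_E b E. f x)) (lists A)"
    unfolding A_def by (rule has_sum_integral_mu_E[OF b integrable_mu_E_continuous[OF assms]])
  have "?F summable_on lists A"
    using sum by (rule has_sum_imp_summable)
  hence sumh: "?F summable_on (?h ` (A \<times> lists A))"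
    by (rule summable_on_subset_banach) (subst (2) lists_eq, rule subset_insertI)
  hence sumh': "(?F \<circ> ?h) summable_on (A \<times> lists A)"
    using summable_on_reindex[OF inj] by blast
  have inner: "infsum (\<lambda>X. (?F \<circ> ?h) (a, X)) (lists A) =
      (LINT x | mu_E b E. f ((real a + x) / real b)) / real b" if "a \<in> A" for a
  proof -
    have "a < b" using that by (simp add: A_def allowed_digits_def)
    \<comment> \<open>Integrality sharpens \<open>a < b\<close> to a bound that keeps
      \<open>(a + x) / b\<close> in \<open>{0..1}\<close> even at \<open>x = 1\<close>.\<close>
    hence "real a + 1 \<le> real b" by linarith
    hence "continuous_on {0..1} (\<lambda>x. f ((real a + x) / real b))"
      using b by (intro continuous_on_compose2[OF assms(4)] continuous_intros) (auto simp: field_simps)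
    from has_sum_integral_mu_E[OF b integrable_mu_E_continuous[OF assms(1-3) this]]
    have "((\<lambda>X. f ((real a + string_point b X) / real b) / real b ^ length X / real b) has_sum
        (LINT x | mu_E b E. f ((real a + x) / real b)) / real b) (lists A)"
      unfolding A_def by (rule has_sum_divide_const)
    thus ?thesis
      using b by (intro infsumI) (simp add: string_point_snoc mult.commute)
  qed
  have "(LINT x | mu_E b E. f x) = infsum ?F (lists A)"
    using infsumI[OF sum] by simp
  also have "\<dots> = f 0 + infsum ?F (?h ` (A \<times> lists A))"
    by (subst lists_eq, subst infsum_insert[OF sumh]) auto
  also have "infsum ?F (?h ` (A \<times> lists A)) = infsum (?F \<circ> ?h) (A \<times> lists A)"
    by (rule infsum_reindex[OF inj])
  also have "\<dots> = infsum (\<lambda>a. infsum (\<lambda>X. (?F \<circ> ?h) (a, X)) (lists A)) A"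
    using sumh' by (rule infsum_Sigma_banach[symmetric])
  also have "\<dots> = (\<Sum>a\<in>A. infsum (\<lambda>X. (?F \<circ> ?h) (a, X)) (lists A))"
    by (simp add: A_def finite_allowed_digits)
  also have "\<dots> = (\<Sum>a\<in>A. LINT x | mu_E b E. f ((real a + x) / real b)) / real b"
    unfolding sum_divide_distrib by (rule sum.cong[OF refl inner])
  finally show ?thesis by (simp add: A_def)
qed

text \<open>If \<open>m\<close> has leading digit \<open>a\<close> followed by \<open>X\<close>,
  then \<open>1 / m\<close> is the weight of \<open>X\<close> times the value of
  \<open>1 / (a + x)\<close> at the point of \<open>X\<close>.\<close>

lemma kempner_sum_eq_integral:
  assumes "b \<ge> 2" "E \<subseteq> {0..<b}" "E \<noteq> {}"
  shows "kempner_sum b E =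
           (\<Sum>a\<in>allowed_digits b E - {0}. LINT x | mu_E b E. 1 / (real a + x))"
proof -
  define A where "A = allowed_digits b E"
  have b: "b > 0" using assms by simp
  let ?h = "\<lambda>(a, X). string_value b (X @ [a])"
  let ?r = "\<lambda>m. 1 / real m"
  have bij: "bij_betw ?h ((A - {0}) \<times> lists A) (kempner_set b E)"
    unfolding A_def by (rule bij_betw_kempner_set[OF assms(1)])
  have summable: "(\<lambda>p. ?r (?h p)) summable_on ((A - {0}) \<times> lists A)"
    using kempner_summable[OF assms] summable_on_reindex_bij_betw[OF bij, of ?r] by blast
  have inner: "infsum (\<lambda>X. ?r (?h (a, X))) (lists A) = (LINT x | mu_E b E. 1 / (real a + x))"
    if "a \<in> A - {0}" for a
  proof -
    have "continuous_on {0..1} (\<lambda>x. 1 / (real a + x))"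
      using that by (intro continuous_intros) (auto simp: add_nonneg_eq_0_iff)
    from has_sum_integral_mu_E[OF b integrable_mu_E_continuous[OF assms this]]
    have "((\<lambda>X. 1 / (real a + string_point b X) / real b ^ length X) has_sum
        (LINT x | mu_E b E. 1 / (real a + x))) (lists A)"
      unfolding A_def .
    moreover have "1 / (real a + string_point b X) / real b ^ length X = ?r (?h (a, X))" for X
    proof -
      have "(real a + string_point b X) * real b ^ length X = real (string_value b (X @ [a]))"
        using b by (simp add: string_point_def string_value_snoc distrib_right)
      thus ?thesis by simp
    qed
    ultimately show ?thesis by (simp add: infsumI)
  qed
  have "kempner_sum b E = infsum (\<lambda>p. ?r (?h p)) ((A - {0}) \<times> lists A)"
    unfolding kempner_sum_def using infsum_reindex_bij_betw[OF bij, of ?r] by simp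
  also have "\<dots> = infsum (\<lambda>a. infsum (\<lambda>X. ?r (?h (a, X))) (lists A)) (A - {0})"
    using summable by (rule infsum_Sigma_banach[symmetric])
  also have "\<dots> = (\<Sum>a\<in>A - {0}. infsum (\<lambda>X. ?r (?h (a, X))) (lists A))"
    by (simp add: A_def finite_allowed_digits)
  also have "\<dots> = (\<Sum>a\<in>A - {0}. LINT x | mu_E b E. 1 / (real a + x))"
    by (rule sum.cong[OF refl inner])
  finally show ?thesis by (simp add: A_def)
qed

section \<open>The formula for Kempner sums\<close>

lemma continuous_on_Digamma_pos:
  fixes f :: "real \<Rightarrow> real"
  assumes "continuous_on S f" "\<And>x. x \<in> S \<Longrightarrow> f x > 0"
  shows "continuous_on S (\<lambda>x. Digamma (f x))"
proof (rule continuous_on_compose2[OF continuous_on_Polygamma assms(1)])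
  show "f ` S \<subseteq> {0<..}" using assms(2) by auto
qed (auto elim!: nonpos_Ints_cases)

theorem theorem1:
  fixes b :: nat and E :: "nat set"
  assumes "b \<ge> 2" and "E \<subseteq> {0..<b}" and "E \<noteq> {}"
  shows "kempner_sum b E =
           real b / real (card E) * ln (real b) +
           1 / real b * (LINT x | mu_E b E.
             (\<Sum>a\<in>shifted_excluded b E. Digamma ((real a + x) / real b) - Digamma 1))"
proof -
  define A where "A = allowed_digits b E"
  define E1 where "E1 = shifted_excluded b E"
  \<comment> \<open>The digit \<open>0\<close> is replaced by \<open>b\<close> because \<open>Digamma (1 + x / b)\<close> is already of the form
    \<open>Digamma ((a + x) / b)\<close> with \<open>a = b\<close>, so no recurrence step is applied to it.\<close>
  define \<sigma> where "\<sigma> = (\<lambda>a. if a = 0 then b else a)"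
  define \<phi> where "\<phi> = (\<lambda>a x. Digamma ((real a + x) / real b) - Digamma 1 :: real)"
  \<comment> \<open>Subtracting \<open>Digamma 1\<close> makes \<open>g 0 = 0\<close>, so the empty
    string contributes nothing to the self-similarity relation.\<close>
  define g where "g = (\<lambda>x. Digamma (1 + x) - Digamma 1 :: real)"
  have b: "b > 0" using assms by simp
  have finE: "finite E" using assms finite_subset by blast
  have finA: "finite A" by (simp add: A_def finite_allowed_digits)
  interpret finite_measure "mu_E b E" by (rule finite_measure_mu_E[OF assms])
  have total: "measure (mu_E b E) (space (mu_E b E)) = real b / real (card E)"
    using emeasure_mu_E_total[OF assms] by (simp add: measure_def space_mu_E)
  have int_\<phi>: "integrable (mu_E b E) (\<phi> a)" if "a > 0" for a
    unfolding \<phi>_def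
    by (intro integrable_mu_E_continuous[OF assms] continuous_intros continuous_on_Digamma_pos)
       (use that b in auto)
  have cont_g: "continuous_on {0..1} g"
    unfolding g_def by (intro continuous_intros continuous_on_Digamma_pos) auto
  have int_g: "integrable (mu_E b E) g"
    by (rule integrable_mu_E_continuous[OF assms cont_g])
  have int_inv: "integrable (mu_E b E) (\<lambda>x. 1 / (real a + x))" if "a > 0" for a
    by (intro integrable_mu_E_continuous[OF assms] continuous_intros)
       (use that in \<open>auto simp: add_nonneg_eq_0_iff\<close>)
  have inj: "inj_on \<sigma> A"
    by (auto simp: inj_on_def \<sigma>_def A_def allowed_digits_def split: if_splits)
  \<comment> \<open>The relabelled allowed digits and \<open>E1\<close> partition
    \<open>{1..b}\<close>, the range of the multiplication formula.\<close>
  have split: "{1..b} = \<sigma> ` A \<union> E1" "\<sigma> ` A \<inter> E1 = {}"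
  proof -
    have "\<sigma> ` A = (if 0 \<in> E then {1..<b} - E else insert b ({1..<b} - E))"
      using b by (auto simp: \<sigma>_def A_def allowed_digits_def image_iff Suc_le_eq)
    moreover have "E1 = (if 0 \<in> E then insert b (E \<inter> {1..<b}) else E \<inter> {1..<b})"
    proof -
      have "x < b" if "x \<in> E" for x using that assms(2) by auto
      moreover have "0 < x" if "x \<in> E" "0 \<notin> E" for x using that by (cases x) auto
      ultimately show ?thesis by (auto simp: E1_def shifted_excluded_def Suc_le_eq)
    qed
    ultimately show "{1..b} = \<sigma> ` A \<union> E1" "\<sigma> ` A \<inter> E1 = {}"
      using b by auto
  qed
  have finE1: "finite E1" using finE by (simp add: E1_def shifted_excluded_def)
  have E1_pos: "a > 0" if "a \<in> E1" for a
  proof -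
    have "a \<in> {1..b}" using that split(1) by blast
    thus ?thesis by simp
  qed

  \<comment> \<open>The recurrence at \<open>y = (a + x) / b\<close> adds
    \<open>1 / y = b / (a + x)\<close>, which is \<open>b\<close> times the integrand representing
    the Kempner sum.\<close>
  have step: "(LINT x | mu_E b E. g ((real a + x) / real b)) =
      (LINT x | mu_E b E. \<phi> (\<sigma> a) x) +
      (if a = 0 then 0 else real b * (LINT x | mu_E b E. 1 / (real a + x)))" for a
  proof (cases "a = 0")
    case True
    have "g (x / real b) = \<phi> b x" for x using b by (simp add: g_def \<phi>_def add_divide_distrib)
    thus ?thesis using True by (simp add: \<sigma>_def)
  next
    case False
    have "(LINT x | mu_E b E. g ((real a + x) / real b)) =
        (LINT x | mu_E b E. \<phi> a x + real b * (1 / (real a + x)))"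
    proof (rule Bochner_Integration.integral_cong[OF refl])
      fix x assume "x \<in> space (mu_E b E)"
      hence "(real a + x) / real b \<noteq> 0"
        using False b by (auto simp: space_mu_E add_nonneg_eq_0_iff)
      thus "g ((real a + x) / real b) = \<phi> a x + real b * (1 / (real a + x))"
        using Digamma_plus1[of "(real a + x) / real b"] by (simp add: g_def \<phi>_def add.commute)
    qed
    also have "\<dots> = (LINT x | mu_E b E. \<phi> a x) + real b * (LINT x | mu_E b E. 1 / (real a + x))"
      using False int_\<phi>[of a] int_inv[of a]
      by (subst Bochner_Integration.integral_add) (auto simp del: times_divide_eq_right)
    finally show ?thesis using False by (simp add: \<sigma>_def)
  qed

  have gauss: "(\<Sum>a=1..b. \<phi> a x) = real b * g x - real b * ln (real b)" if "x \<ge> 0" for x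
  proof -
    \<comment> \<open>Shifting the index by one moves the base point to \<open>z = 1 + x\<close>, so
      that the multiplication formula yields \<open>g\<close> itself.\<close>
    have "(\<Sum>a=1..b. Digamma ((real a + x) / real b)) = (\<Sum>a<b. Digamma ((real a + (1 + x)) / real b))"
      by (rule sum.reindex_bij_witness[of _ Suc "\<lambda>a. a - 1"]) (auto simp: algebra_simps)
    also have "\<dots> = real b * Digamma (1 + x) - real b * ln (real b)"
      using that b by (intro Digamma_multiplication) auto
    finally show ?thesis
      by (simp add: \<phi>_def g_def sum_subtractf right_diff_distrib del: Digamma_1)
  qed

  \<comment> \<open>This is the self-similarity relation scaled by \<open>b\<close>. In the chain
    below \<open>b\<close> times the integral of \<open>g\<close> reappears on the right and
    cancels.\<close>
  have "real b * (LINT x | mu_E b E. g x) = (\<Sum>a\<in>A. LINT x | mu_E b E. g ((real a + x) / real b))"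
    using integral_mu_E_self_similar[OF assms cont_g] b by (simp add: g_def A_def)
  also have "\<dots> = (\<Sum>a\<in>A. LINT x | mu_E b E. \<phi> (\<sigma> a) x) +
      (\<Sum>a\<in>A. if a = 0 then 0 else real b * (LINT x | mu_E b E. 1 / (real a + x)))"
    by (simp add: step sum.distrib)
  also have "(\<Sum>a\<in>A. if a = 0 then 0 else real b * (LINT x | mu_E b E. 1 / (real a + x))) =
      (\<Sum>a\<in>A - {0}. real b * (LINT x | mu_E b E. 1 / (real a + x)))"
    using finA by (intro sum.mono_neutral_cong_right) auto
  also have "\<dots> = real b * kempner_sum b E"
    by (simp add: kempner_sum_eq_integral[OF assms] A_def sum_distrib_left)
  also have "(\<Sum>a\<in>A. LINT x | mu_E b E. \<phi> (\<sigma> a) x) = (\<Sum>a\<in>\<sigma> ` A. LINT x | mu_E b E. \<phi> a x)"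
    using inj by (simp add: sum.reindex)
  \<comment> \<open>Passing to the complement in \<open>{1..b}\<close> trades allowed digits for
    excluded ones.\<close>
  also have "\<dots> = (\<Sum>a=1..b. LINT x | mu_E b E. \<phi> a x) - (\<Sum>a\<in>E1. LINT x | mu_E b E. \<phi> a x)"
    using split finA finE1 by (simp add: sum.union_disjoint)
  also have "(\<Sum>a=1..b. LINT x | mu_E b E. \<phi> a x) = (LINT x | mu_E b E. (\<Sum>a=1..b. \<phi> a x))"
    using int_\<phi> by (intro Bochner_Integration.integral_sum[symmetric]) auto
  also have "\<dots> = (LINT x | mu_E b E. real b * g x - real b * ln (real b))"
    by (intro Bochner_Integration.integral_cong refl gauss) (simp add: space_mu_E)
  \<comment> \<open>The total mass \<open>b / card E\<close> multiplies the constant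
    \<open>b * ln b\<close>, giving the logarithmic term.\<close>
  also have "\<dots> = real b * (LINT x | mu_E b E. g x) - real b / real (card E) * (real b * ln (real b))"
    using int_g by (simp add: total)
  also have "(\<Sum>a\<in>E1. LINT x | mu_E b E. \<phi> a x) = (LINT x | mu_E b E. (\<Sum>a\<in>E1. \<phi> a x))"
    using int_\<phi> E1_pos by (intro Bochner_Integration.integral_sum[symmetric]) auto
  finally have "real b * kempner_sum b E = real b / real (card E) * (real b * ln (real b)) +
      (LINT x | mu_E b E. (\<Sum>a\<in>E1. \<phi> a x))" by simp
  hence "kempner_sum b E = real b / real (card E) * ln (real b) +
      1 / real b * (LINT x | mu_E b E. (\<Sum>a\<in>E1. \<phi> a x))"
    using b by (simp add: field_simps)
  thus ?thesis by (simp add: E1_def \<phi>_def)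
qed

end
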